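(* Let $\mathcal S,\mathcal A$ be finite nonempty sets, $\mathcal T(\cdot|s,a)$ a transition kernel from $\mathcal S\times\mathcal A$ to $\mathcal S$, $\lambda>0$ and $\gamma\in[0,1)$. Let $\bar\pi:\mathcal S\to\mathcal P(\mathcal A)$ be a fixed policy with $\bar\pi(a|s)>0$ for all $(s,a)\in\mathcal S\times\mathcal A$, and let $v:\mathcal S\to\mathbb R$ be an arbitrary function. Then there is a unique reward function $f:\mathcal S\times\mathcal A\to\mathbb R$ such that the entropy-regularized MDP $(\mathcal S,\mathcal A,\mathcal T,f,\gamma,\lambda)$ has optimal value function $V^*_\lambda=v$ and entropy-regularized optimal policy $\pi^*_\lambda=\bar\pi$, and it is given by $$f(s,a)=\lambda\log\bar\pi(a|s)-\gamma\sum_{s'\in\mathcal S}\mathcal T(s'|s,a)v(s')+v(s),\qquad (s,a)\in\mathcal S\times\mathcal A.$$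
   Context: $\mathcal P(X)$ is the set of probability distributions on a finite set $X$. A policy is a map $\pi:\mathcal S\to\mathcal P(\mathcal A)$, written $\pi(a|s)$. Under $\mathbb E^\pi_s$, the process starts at $S_0=s$, $A_t\sim\pi(\cdot|S_t)$ and $S_{t+1}\sim\mathcal T(\cdot|S_t,A_t)$. The entropy-regularized value of $\pi$ is $$V^\pi_\lambda(s)=\mathbb E^\pi_s\Big[\sum_{t=0}^\infty\gamma^t\big(f(S_t,A_t)-\lambda\log\pi(A_t|S_t)\big)\Big],$$ with the convention $0\log 0=0$, and the optimal value is $V^*_\lambda(s)=\max_\pi V^\pi_\lambda(s)$. Standard facts: $V^*_\lambda$ is the solution of $V^*_\lambda(s)=\lambda\log\sum_{a}\exp(Q^*_\lambda(s,a)/\lambda)$ with $Q^*_\lambda(s,a)=f(s,a)+\gamma\sum_{s'}\mathcal T(s'|s,a)V^*_\lambda(s')$, and the entropy-regularized optimal policy is $\pi^*_\lambda(a|s)=\exp\big((Q^*_\lambda(s,a)-V^*_\lambda(s))/\lambda\big)$. *)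

theory Defs
  imports "HOL-Probability.Probability"
begin

type_synonym ('s, 'a) kernel = "'s \<Rightarrow> 'a \<Rightarrow> 's pmf"
type_synonym ('s, 'a) policy = "'s \<Rightarrow> 'a pmf"

text \<open>
  Conditional law of the pair \<open>(S\<^sub>n, A\<^sub>n)\<close> given the history \<open>\<omega>\<close> of the
  pairs with index below \<open>n\<close>, for the process started in state \<open>s\<close>.
\<close>

primrec step_pmf ::
    "('s, 'a) kernel \<Rightarrow> ('s, 'a) policy \<Rightarrow> 's \<Rightarrow> nat \<Rightarrow> (nat \<Rightarrow> 's \<times> 'a) \<Rightarrow> ('s \<times> 'a) pmf"
where
  "step_pmf T \<pi> s 0 \<omega> = map_pmf (Pair s) (\<pi> s)"
| "step_pmf T \<pi> s (Suc n) \<omega> =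
     bind_pmf (T (fst (\<omega> n)) (snd (\<omega> n))) (\<lambda>s'. map_pmf (Pair s') (\<pi> s'))"

text \<open>
  The law of the state-action process \<open>t \<mapsto> (S\<^sub>t, A\<^sub>t)\<close> on the infinite product
  space, obtained from the one-step laws by the Ionescu-Tulcea theorem.
\<close>

definition trajectory ::
    "('s, 'a) kernel \<Rightarrow> ('s, 'a) policy \<Rightarrow> 's \<Rightarrow> (nat \<Rightarrow> 's \<times> 'a) measure"
where
  "trajectory T \<pi> s =
     projective_family.lim UNIV
       (Ionescu_Tulcea.CI (\<lambda>n \<omega>. measure_pmf (step_pmf T \<pi> s n \<omega>)) (\<lambda>_. count_space UNIV))
       (\<lambda>_. count_space UNIV)"

text \<open>
  Since \<open>ln 0\<close> is a finite junk value, actions of probability \<open>0\<close> contribute nothing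
  to the expectation, in accordance with the convention \<open>0 log 0 = 0\<close>.
\<close>

definition regularized_value ::
    "('s, 'a) kernel \<Rightarrow> ('s \<Rightarrow> 'a \<Rightarrow> real) \<Rightarrow> real \<Rightarrow> real \<Rightarrow> ('s, 'a) policy \<Rightarrow> 's \<Rightarrow> real"
where
  "regularized_value T f \<gamma> lam \<pi> s =
     (\<integral>\<omega>. (\<Sum>t. \<gamma> ^ t * (f (fst (\<omega> t)) (snd (\<omega> t))
                       - lam * ln (pmf (\<pi> (fst (\<omega> t))) (snd (\<omega> t)))))
        \<partial>trajectory T \<pi> s)"

text \<open>
  The maximum over policies, taken separately in each state. For finite state and action
  spaces, \<open>lam > 0\<close> and \<open>0 \<le> \<gamma> < 1\<close> it is attained, so \<open>GREATEST\<close> is meaningful.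
\<close>

definition optimal_value ::
    "('s, 'a) kernel \<Rightarrow> ('s \<Rightarrow> 'a \<Rightarrow> real) \<Rightarrow> real \<Rightarrow> real \<Rightarrow> 's \<Rightarrow> real"
where
  "optimal_value T f \<gamma> lam s = (GREATEST x. \<exists>\<pi>. x = regularized_value T f \<gamma> lam \<pi> s)"

definition optimal_policy ::
    "('s, 'a) kernel \<Rightarrow> ('s \<Rightarrow> 'a \<Rightarrow> real) \<Rightarrow> real \<Rightarrow> real \<Rightarrow> ('s, 'a) policy \<Rightarrow> bool"
where
  "optimal_policy T f \<gamma> lam \<pi> \<longleftrightarrow>
     (\<forall>\<pi>' s. regularized_value T f \<gamma> lam \<pi>' s \<le> regularized_value T f \<gamma> lam \<pi> s)"

lemma Ionescu_Tulcea_step: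
  fixes T :: "('s::finite, 'a::finite) kernel"
  shows "Ionescu_Tulcea (\<lambda>n \<omega>. measure_pmf (step_pmf T \<pi> s n \<omega>)) (\<lambda>_. count_space UNIV)"
proof
  fix n
  let ?M = "\<lambda>_::nat. count_space (UNIV :: ('s \<times> 'a) set)"
  show "(\<lambda>\<omega>. measure_pmf (step_pmf T \<pi> s n \<omega>))
      \<in> measurable (PiM {0..<n} ?M) (subprob_algebra (count_space UNIV))"
  proof (cases n)
    case 0
    then show ?thesis
      by (simp add: space_subprob_algebra subprob_space_measure_pmf)
  next
    case (Suc m)
    have proj: "(\<lambda>\<omega>. \<omega> m) \<in> measurable (PiM {0..<n} ?M) (count_space UNIV)"
      using Suc by (intro measurable_component_singleton[where M = ?M]) auto
    have kern: "(\<lambda>p. measure_pmf (bind_pmf (T (fst p) (snd p)) (\<lambda>s'. map_pmf (Pair s') (\<pi> s'))))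
        \<in> measurable (count_space UNIV) (subprob_algebra (count_space UNIV))"
      by (simp add: space_subprob_algebra subprob_space_measure_pmf)
    show ?thesis
      using measurable_compose[OF proj kern] Suc by simp
  qed
qed

lemma sets_trajectory:
  fixes T :: "('s::finite, 'a::finite) kernel"
  shows "sets (trajectory T \<pi> s) = sets (PiM UNIV (\<lambda>_. count_space UNIV))"
proof -
  interpret IT: Ionescu_Tulcea "\<lambda>n \<omega>. measure_pmf (step_pmf T \<pi> s n \<omega>)" "\<lambda>_. count_space UNIV"
    by (rule Ionescu_Tulcea_step)
  show ?thesis
    unfolding trajectory_def by (rule IT.PF.sets_lim)
qed

lemma prob_space_trajectory:
  fixes T :: "('s::finite, 'a::finite) kernel"
  shows "prob_space (trajectory T \<pi> s)"
proof -
  interpret IT: Ionescu_Tulcea "\<lambda>n \<omega>. measure_pmf (step_pmf T \<pi> s n \<omega>)" "\<lambda>_. count_space UNIV"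
    by (rule Ionescu_Tulcea_step)
  have "prob_space (distr IT.PF.lim (PiM {} (\<lambda>_. count_space UNIV)) (\<lambda>\<omega>. restrict \<omega> {}))"
    using IT.distr_lim[of "{}"] IT.PF.prob_space_P[of "{}"] by simp
  then show ?thesis
    unfolding trajectory_def
    by (rule prob_space_distrD[rotated]) (simp add: measurable_cong_sets[OF IT.PF.sets_lim refl])
qed

lemma emeasure_trajectory_cylinder:
  fixes T :: "('s::finite, 'a::finite) kernel"
  shows "emeasure (trajectory T \<pi> s) {\<omega>. \<forall>i<n. \<omega> i = x i} = (\<Prod>i<n. pmf (step_pmf T \<pi> s i x) (x i))"
proof -
  let ?M = "\<lambda>_::nat. count_space (UNIV :: ('s \<times> 'a) set)"
  let ?X = "\<lambda>n. {restrict x {0..<n}}"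
  interpret IT: Ionescu_Tulcea "\<lambda>n \<omega>. measure_pmf (step_pmf T \<pi> s n \<omega>)" ?M
    by (rule Ionescu_Tulcea_step)
  have X_eq: "?X n = PiE {0..<n} (\<lambda>i. {x i})" for n
    by (auto simp: PiE_iff extensional_def restrict_def fun_eq_iff)
  have X[measurable]: "?X n \<in> sets (PiM {0..<n} ?M)" for n
    unfolding X_eq by (intro sets_PiM_I_finite) auto
  have step_cong: "step_pmf T \<pi> s n (restrict x {0..<n}) = step_pmf T \<pi> s n x" for n
    by (cases n) auto
  have C: "emeasure (IT.C 0 n (\<lambda>_. undefined)) (?X n) = (\<Prod>i<n. pmf (step_pmf T \<pi> s i x) (x i))" for n
  proof (induction n)
    case 0
    then show ?case
      using emeasure_return[OF X[of 0], of "\<lambda>_. undefined"] by (simp add: restrict_def)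
  next
    case (Suc n)
    let ?C = "IT.C 0 n (\<lambda>_. undefined)"
    have sp: "space ?C = space (PiM {0..<n} ?M)" "sets ?C = sets (PiM {0..<n} ?M)"
      using IT.space_C[of "\<lambda>_. undefined" 0 n] IT.sets_C[of "\<lambda>_. undefined" 0 n] by auto
    have eP: "emeasure (IT.eP n \<omega>) (?X (Suc n))
        = ennreal (pmf (step_pmf T \<pi> s n x) (x n)) * indicator (?X n) \<omega>"
      if \<omega>: "\<omega> \<in> space (PiM {0..<n} ?M)" for \<omega>
    proof -
      have ext: "\<omega> \<in> extensional {0..<n}"
        using \<omega> by (auto simp: space_PiM PiE_def)
      have *: "fun_upd \<omega> n y = restrict x {0..<Suc n} \<longleftrightarrow> \<omega> = restrict x {0..<n} \<and> y = x n" for y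
      proof
        assume eq: "fun_upd \<omega> n y = restrict x {0..<Suc n}"
        have "\<omega> i = restrict x {0..<n} i" for i
          using fun_cong[OF eq, of i] ext by (cases "i = n") (auto simp: extensional_def restrict_def split: if_splits)
        then show "\<omega> = restrict x {0..<n} \<and> y = x n"
          using fun_cong[OF eq, of n] by auto
      qed (auto simp: fun_eq_iff restrict_def)
      have "(\<lambda>y. fun_upd \<omega> n y) -` ?X (Suc n) = (if \<omega> \<in> ?X n then {x n} else {})"
        by (simp only: vimage_def insert_iff empty_iff * simp_thms) auto
      then show ?thesis
        using IT.emeasure_eP[OF \<omega> X[of "Suc n"]] step_cong[of n]
        by (auto simp: emeasure_pmf_single)
    qed
    have "emeasure (IT.C 0 (Suc n) (\<lambda>_. undefined)) (?X (Suc n))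
        = (\<integral>\<^sup>+\<omega>. emeasure (IT.eP n \<omega>) (?X (Suc n)) \<partial>?C)"
      using IT.measurable_eP[of n] X[of "Suc n"]
      by (simp add: emeasure_bind[where N = "PiM {0..<Suc n} ?M"] sp
          measurable_cong_sets[OF sp(2) refl] IT.space_C)
    also have "\<dots> = (\<integral>\<^sup>+\<omega>. ennreal (pmf (step_pmf T \<pi> s n x) (x n)) * indicator (?X n) \<omega> \<partial>?C)"
      by (intro nn_integral_cong) (simp add: eP sp)
    also have "\<dots> = ennreal (pmf (step_pmf T \<pi> s n x) (x n)) * emeasure ?C (?X n)"
      using X[of n] by (intro nn_integral_cmult_indicator) (simp add: sp)
    also have "\<dots> = (\<Prod>i<Suc n. pmf (step_pmf T \<pi> s i x) (x i))"
      by (simp only: Suc.IH) (simp add: ennreal_mult' [symmetric] prod_nonneg mult.commute)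
    finally show ?case .
  qed
  have "{\<omega>. \<forall>i<n. \<omega> i = x i} = IT.PF.emb UNIV {0..<n} (?X n)"
    unfolding X_eq by (auto simp: prod_emb_def space_PiM PiE_iff restrict_def)
  then have "emeasure (trajectory T \<pi> s) {\<omega>. \<forall>i<n. \<omega> i = x i} = emeasure (IT.CI {0..<n}) (?X n)"
    unfolding trajectory_def using IT.lim[of "{0..<n}" "?X n"] X[of n] by simp
  also have "\<dots> = emeasure (IT.C 0 n (\<lambda>_. undefined)) (?X n)"
    using IT.emeasure_CI[of "{0..<n}" n "?X n"] X[of n]
    by (simp add: prod_emb_id sets.sets_into_space space_PiM)
  finally show ?thesis
    by (simp add: C)
qed

lemma summable_regularized_reward:
  fixes f :: "'s::finite \<Rightarrow> 'a::finite \<Rightarrow> real"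
  assumes "0 \<le> \<gamma>" "\<gamma> < 1"
  shows "summable (\<lambda>t. \<gamma> ^ t * (f (fst (\<omega> t)) (snd (\<omega> t))
                       - lam * ln (pmf (\<pi> (fst (\<omega> t))) (snd (\<omega> t)))))"
proof -
  define g where "g = (\<lambda>p. f (fst p) (snd p) - lam * ln (pmf (\<pi> (fst p)) (snd p)))"
  have "\<bar>g p\<bar> \<le> Max (range (\<lambda>p. \<bar>g p\<bar>))" for p
    by (rule Max_ge) auto
  then have "norm (\<gamma> ^ t * g (\<omega> t)) \<le> \<gamma> ^ t * Max (range (\<lambda>p. \<bar>g p\<bar>))" for t
    using assms by (simp add: abs_mult mult_left_mono)
  moreover have "summable (\<lambda>t. \<gamma> ^ t * Max (range (\<lambda>p. \<bar>g p\<bar>)))"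
    using assms by (intro summable_mult2 summable_geometric) auto
  ultimately have "summable (\<lambda>t. \<gamma> ^ t * g (\<omega> t))"
    by (rule summable_comparison_test'[rotated])
  then show ?thesis
    by (simp add: g_def)
qed

lemma integrable_regularized_return:
  fixes T :: "('s::finite, 'a::finite) kernel" and f :: "'s \<Rightarrow> 'a \<Rightarrow> real"
  assumes "0 \<le> \<gamma>" "\<gamma> < 1"
  shows "integrable (trajectory T \<pi> s)
           (\<lambda>\<omega>. \<Sum>t. \<gamma> ^ t * (f (fst (\<omega> t)) (snd (\<omega> t))
                       - lam * ln (pmf (\<pi> (fst (\<omega> t))) (snd (\<omega> t)))))"
proof -
  define g where "g = (\<lambda>p. f (fst p) (snd p) - lam * ln (pmf (\<pi> (fst p)) (snd p)))"
  define B where "B = Max (range (\<lambda>p. \<bar>g p\<bar>))"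
  interpret prob_space "trajectory T \<pi> s"
    by (rule prob_space_trajectory)
  have B: "\<bar>g p\<bar> \<le> B" for p
    unfolding B_def by (rule Max_ge) auto
  have bound: "norm (\<gamma> ^ t * g (\<omega> t)) \<le> \<gamma> ^ t * B" for t \<omega>
    using assms B by (simp add: abs_mult mult_left_mono)
  have summ: "summable (\<lambda>t. \<gamma> ^ t * B)"
    using assms by (intro summable_mult2 summable_geometric) auto
  have comp: "(\<lambda>\<omega>. g (\<omega> t)) \<in> borel_measurable (trajectory T \<pi> s)" for t
  proof -
    have "(\<lambda>\<omega>. \<omega> t) \<in> measurable (PiM UNIV (\<lambda>_. count_space UNIV)) (count_space UNIV)"
      by (rule measurable_component_singleton) simp
    then have "(\<lambda>\<omega>. g (\<omega> t)) \<in> borel_measurable (PiM UNIV (\<lambda>_. count_space UNIV))"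
      by (rule measurable_compose) simp
    then show ?thesis
      by (simp add: measurable_cong_sets[OF sets_trajectory refl])
  qed
  have "integrable (trajectory T \<pi> s) (\<lambda>\<omega>. \<Sum>t. \<gamma> ^ t * g (\<omega> t))"
  proof (rule integrable_const_bound[where B = "\<Sum>t. \<gamma> ^ t * B"])
    show "AE \<omega> in trajectory T \<pi> s. norm (\<Sum>t. \<gamma> ^ t * g (\<omega> t)) \<le> (\<Sum>t. \<gamma> ^ t * B)"
      using bound summ by (intro AE_I2 norm_suminf_le) auto
    show "(\<lambda>\<omega>. \<Sum>t. \<gamma> ^ t * g (\<omega> t)) \<in> borel_measurable (trajectory T \<pi> s)"
      using comp by (intro borel_measurable_suminf borel_measurable_times) auto
  qed
  then show ?thesis
    by (simp add: g_def)
qed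

end

theory Submission
  imports Defs
begin

text \<open>
  The marginals of the trajectory are iterates of the averaging operator of the policy, so its
  regularized value satisfies a linear Bellman equation, and by the minimum principle any
  one-sided solution of that equation compares with the value. If \<open>soft_Q = lam * ln \<rho> + v\<close>, the
  Bellman defect of \<open>v\<close> under a policy \<open>\<pi>\<close> is \<open>lam\<close> times the relative entropy of \<open>\<pi>\<close> with
  respect to \<open>\<rho>\<close>; by Gibbs' inequality \<open>v\<close> is then the optimal value and \<open>\<rho>\<close> the only optimal
  policy. Conversely, an optimal policy must be the softmax of its own Q-function, since
  otherwise that softmax would improve on it; this determines the reward without first solving
  the nonlinear optimality equation.
\<close>

section \<open>Marginals of the trajectory\<close>

definition policy_mean :: "('s, 'a) policy \<Rightarrow> ('s \<times> 'a \<Rightarrow> real) \<Rightarrow> 's \<Rightarrow> real" where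
  "policy_mean \<pi> h s = (\<Sum>a\<in>UNIV. pmf (\<pi> s) a * h (s, a))"

definition next_mean :: "('s, 'a) kernel \<Rightarrow> ('s \<Rightarrow> real) \<Rightarrow> 's \<times> 'a \<Rightarrow> real" where
  "next_mean T u p = (\<Sum>s'\<in>UNIV. pmf (T (fst p) (snd p)) s' * u s')"

text \<open>\<open>PiE\<close> fixes all entries from \<open>n\<close> on to
  \<open>undefined\<close>: histories over a finite type then form a finite set, yet stay total
  functions that \<open>step_pmf\<close> accepts.\<close>

definition paths :: "nat \<Rightarrow> (nat \<Rightarrow> 'p) set" where
  "paths n = PiE {..<n} (\<lambda>_. UNIV)"

lemma finite_paths: "finite (paths n :: (nat \<Rightarrow> 'p::finite) set)"
  by (simp add: paths_def finite_PiE)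

lemma sum_paths_Suc:
  fixes G :: "(nat \<Rightarrow> 'p::finite) \<Rightarrow> real"
  shows "(\<Sum>x\<in>paths (Suc n). G x) = (\<Sum>x\<in>paths n. \<Sum>y\<in>UNIV. G (x(n := y)))"
proof -
  have "paths (Suc n) = (\<lambda>(y, x). x(n := y)) ` (UNIV \<times> paths n :: ('p \<times> (nat \<Rightarrow> 'p)) set)"
    by (simp add: paths_def lessThan_Suc PiE_insert_eq)
  moreover have "inj_on (\<lambda>(y, x). x(n := y)) (UNIV \<times> paths n :: ('p \<times> (nat \<Rightarrow> 'p)) set)"
    unfolding paths_def by (rule inj_combinator) simp
  ultimately have "(\<Sum>x\<in>paths (Suc n). G x) = (\<Sum>(y, x)\<in>UNIV \<times> paths n. G (x(n := y)))"
    by (simp only: sum.reindex o_def case_prod_unfold)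
  also have "\<dots> = (\<Sum>y\<in>UNIV. \<Sum>x\<in>paths n. G (x(n := y)))"
    by (simp add: sum.cartesian_product)
  also have "\<dots> = (\<Sum>x\<in>paths n. \<Sum>y\<in>UNIV. G (x(n := y)))"
    by (rule sum.swap)
  finally show ?thesis .
qed

lemma measurable_trajectory_component:
  fixes T :: "('s::finite, 'a::finite) kernel"
  shows "(\<lambda>\<omega>. \<omega> n) \<in> measurable (trajectory T \<pi> s) (count_space UNIV)"
  by (subst measurable_cong_sets[OF sets_trajectory refl]) (simp add: measurable_component_singleton)

lemma integrable_trajectory_component:
  fixes T :: "('s::finite, 'a::finite) kernel" and h :: "'s \<times> 'a \<Rightarrow> real"
  shows "integrable (trajectory T \<pi> s) (\<lambda>\<omega>. h (\<omega> n))"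
proof -
  interpret prob_space "trajectory T \<pi> s"
    by (rule prob_space_trajectory)
  have "\<bar>h p\<bar> \<le> Max (range (\<lambda>p. \<bar>h p\<bar>))" for p
    by (rule Max_ge) auto
  moreover have "(\<lambda>\<omega>. h (\<omega> n)) \<in> borel_measurable (trajectory T \<pi> s)"
    by (rule measurable_compose[OF measurable_trajectory_component]) simp
  ultimately show ?thesis
    by (intro integrable_const_bound[where B = "Max (range (\<lambda>p. \<bar>h p\<bar>))"]) auto
qed

lemma space_trajectory:
  fixes T :: "('s::finite, 'a::finite) kernel"
  shows "space (trajectory T \<pi> s) = UNIV"
  using sets_eq_imp_space_eq[OF sets_trajectory[of T \<pi> s]] by (simp add: space_PiM)

text \<open>\<open>h (\<omega> n)\<close> depends on finitely many coordinates only, so it is a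
  finite combination of indicators of cylinders, whose probabilities are known products.\<close>

lemma integral_trajectory_eq_sum_paths:
  fixes T :: "('s::finite, 'a::finite) kernel" and h :: "'s \<times> 'a \<Rightarrow> real"
  shows "(\<integral>\<omega>. h (\<omega> n) \<partial>trajectory T \<pi> s)
    = (\<Sum>x\<in>paths (Suc n). (\<Prod>i<Suc n. pmf (step_pmf T \<pi> s i x) (x i)) * h (x n))"
proof -
  let ?M = "trajectory T \<pi> s"
  let ?cyl = "\<lambda>x :: nat \<Rightarrow> 's \<times> 'a. {\<omega>. \<forall>i<Suc n. \<omega> i = x i}"
  interpret prob_space ?M
    by (rule prob_space_trajectory)
  have cyl: "?cyl x \<in> sets ?M" for x
  proof -
    have "(\<Inter>i\<in>{..<Suc n}. (\<lambda>\<omega>. \<omega> i) -` {x i} \<inter> space ?M) \<in> sets ?M"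
      by (intro sets.finite_INT measurable_sets[OF measurable_trajectory_component]) auto
    also have "(\<Inter>i\<in>{..<Suc n}. (\<lambda>\<omega>. \<omega> i) -` {x i} \<inter> space ?M) = ?cyl x"
      by (auto simp: space_trajectory)
    finally show ?thesis .
  qed
  have meas: "measure ?M (?cyl x) = (\<Prod>i<Suc n. pmf (step_pmf T \<pi> s i x) (x i))" for x
    using emeasure_trajectory_cylinder[of T \<pi> s "Suc n" x]
    by (simp add: measure_def prod_nonneg)
  \<comment> \<open>Exactly one path has a cylinder containing \<open>\<omega>\<close>: the
    restriction \<open>?r\<close> of \<open>\<omega>\<close> to the indices up to
    \<open>n\<close>.\<close>
  have decomp: "h (\<omega> n) = (\<Sum>x\<in>paths (Suc n). indicator (?cyl x) \<omega> * h (x n))" for \<omega>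
  proof -
    let ?r = "restrict \<omega> {..<Suc n}"
    have r: "?r \<in> paths (Suc n)"
      by (simp add: paths_def)
    have eq: "indicator (?cyl x) \<omega> = (if x = ?r then 1 else 0 :: real)" if "x \<in> paths (Suc n)" for x
    proof -
      have "(\<forall>i<Suc n. \<omega> i = x i) \<longleftrightarrow> x = ?r"
        using that by (auto simp: paths_def PiE_def extensional_def fun_eq_iff restrict_def)
      then show ?thesis
        by (auto simp: indicator_def)
    qed
    have "(\<Sum>x\<in>paths (Suc n). indicator (?cyl x) \<omega> * h (x n))
        = (\<Sum>x\<in>paths (Suc n). if x = ?r then h (x n) else 0)"
      by (rule sum.cong) (auto simp only: eq mult_1 mult_zero_left split: if_splits)
    also have "\<dots> = h (\<omega> n)"
      using r by (simp add: finite_paths)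
    finally show ?thesis
      by simp
  qed
  have "(\<integral>\<omega>. h (\<omega> n) \<partial>?M) = (\<integral>\<omega>. (\<Sum>x\<in>paths (Suc n). indicator (?cyl x) \<omega> * h (x n)) \<partial>?M)"
    by (intro Bochner_Integration.integral_cong refl decomp)
  also have "\<dots> = (\<Sum>x\<in>paths (Suc n). measure ?M (?cyl x) * h (x n))"
  proof (subst Bochner_Integration.integral_sum)
    have int: "integrable ?M (indicator (?cyl x) :: _ \<Rightarrow> real)" for x
      by (rule integrable_real_indicator[OF cyl]) (simp add: emeasure_eq_measure del: less_Suc_eq All_less_Suc)
    then show "integrable ?M (\<lambda>\<omega>. indicator (?cyl x) \<omega> * h (x n))" for x
      by (intro integrable_mult_left)
    show "(\<Sum>x\<in>paths (Suc n). \<integral>\<omega>. indicator (?cyl x) \<omega> * h (x n) \<partial>?M)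
        = (\<Sum>x\<in>paths (Suc n). measure ?M (?cyl x) * h (x n))"
      by (simp add: space_trajectory del: less_Suc_eq All_less_Suc)
  qed
  finally show ?thesis
    by (simp only: meas)
qed

lemma expectation_step_pmf:
  fixes T :: "('s::finite, 'a::finite) kernel" and h :: "'s \<times> 'a \<Rightarrow> real"
  shows "(\<Sum>p\<in>UNIV. pmf (step_pmf T \<pi> s 0 \<omega>) p * h p) = policy_mean \<pi> h s"
    and "(\<Sum>p\<in>UNIV. pmf (step_pmf T \<pi> s (Suc n) \<omega>) p * h p) = next_mean T (policy_mean \<pi> h) (\<omega> n)"
proof -
  have sum: "(\<Sum>p\<in>UNIV. pmf M p * k p) = measure_pmf.expectation M k"
    for M :: "'b::finite pmf" and k :: "'b \<Rightarrow> real"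
    by (subst integral_measure_pmf[of UNIV]) auto
  have pair: "measure_pmf.expectation (map_pmf (Pair s') (\<pi> s')) h = policy_mean \<pi> h s'" for s'
    by (simp add: policy_mean_def sum)
  show "(\<Sum>p\<in>UNIV. pmf (step_pmf T \<pi> s 0 \<omega>) p * h p) = policy_mean \<pi> h s"
    unfolding sum by (simp add: pair del: integral_map_pmf)
  show "(\<Sum>p\<in>UNIV. pmf (step_pmf T \<pi> s (Suc n) \<omega>) p * h p) = next_mean T (policy_mean \<pi> h) (\<omega> n)"
    unfolding sum
    by (simp add: pmf_expectation_bind[where A = UNIV] pair next_mean_def del: integral_map_pmf)
qed

lemma step_pmf_cong:
  assumes "\<And>i. i < n \<Longrightarrow> x i = y i"
  shows "step_pmf T \<pi> s n x = step_pmf T \<pi> s n y"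
  using assms by (cases n) auto

lemma integral_trajectory_0:
  fixes T :: "('s::finite, 'a::finite) kernel" and h :: "'s \<times> 'a \<Rightarrow> real"
  shows "(\<integral>\<omega>. h (\<omega> 0) \<partial>trajectory T \<pi> s) = policy_mean \<pi> h s"
  using expectation_step_pmf(1)[of T \<pi> s _ h]
  by (simp add: integral_trajectory_eq_sum_paths sum_paths_Suc) (simp add: paths_def)

text \<open>Markov property: given the path up to time \<open>n\<close>, averaging over the next
  pair leaves a function of the pair at time \<open>n\<close> alone.\<close>

lemma integral_trajectory_Suc:
  fixes T :: "('s::finite, 'a::finite) kernel" and h :: "'s \<times> 'a \<Rightarrow> real"
  shows "(\<integral>\<omega>. h (\<omega> (Suc n)) \<partial>trajectory T \<pi> s)
    = (\<integral>\<omega>. next_mean T (policy_mean \<pi> h) (\<omega> n) \<partial>trajectory T \<pi> s)"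
proof -
  let ?w = "\<lambda>n x. \<Prod>i<n. pmf (step_pmf T \<pi> s i x) (x i)"
  \<comment> \<open>The law at index \<open>i\<close> reads only entries below \<open>i\<close>, so
    overwriting entry \<open>m\<close> changes none of the laws up to index
    \<open>m\<close>.\<close>
  have w: "?w (Suc m) (x(m := y)) = ?w m x * pmf (step_pmf T \<pi> s m x) y" for m x y
  proof -
    have step: "step_pmf T \<pi> s i (x(m := y)) = step_pmf T \<pi> s i x" if "i \<le> m" for i
      using that by (intro step_pmf_cong) auto
    then have "?w m (x(m := y)) = ?w m x"
      by (intro prod.cong) auto
    then show ?thesis
      by (simp add: step)
  qed
  have "(\<integral>\<omega>. h (\<omega> (Suc n)) \<partial>trajectory T \<pi> s)
      = (\<Sum>x\<in>paths (Suc n). \<Sum>y\<in>UNIV. ?w (Suc (Suc n)) (x(Suc n := y)) * h y)"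
    unfolding integral_trajectory_eq_sum_paths by (subst sum_paths_Suc) simp
  also have "\<dots> = (\<Sum>x\<in>paths (Suc n). ?w (Suc n) x *
      (\<Sum>y\<in>UNIV. pmf (step_pmf T \<pi> s (Suc n) x) y * h y))"
    by (simp only: w sum_distrib_left mult.assoc)
  also have "\<dots> = (\<integral>\<omega>. next_mean T (policy_mean \<pi> h) (\<omega> n) \<partial>trajectory T \<pi> s)"
    by (simp only: expectation_step_pmf integral_trajectory_eq_sum_paths)
  finally show ?thesis .
qed

text \<open>The Markov property is applied from the far end: each step replaces \<open>h\<close> by
  \<open>next_mean T (policy_mean \<pi> h)\<close>, so the induction must generalise over
  \<open>h\<close>.\<close>

lemma integral_trajectory:
  fixes T :: "('s::finite, 'a::finite) kernel" and h :: "'s \<times> 'a \<Rightarrow> real"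
  shows "(\<integral>\<omega>. h (\<omega> n) \<partial>trajectory T \<pi> s)
    = ((\<lambda>u. policy_mean \<pi> (next_mean T u)) ^^ n) (policy_mean \<pi> h) s"
proof (induction n arbitrary: h)
  case 0
  then show ?case by (simp add: integral_trajectory_0)
next
  case (Suc n)
  show ?case
    by (simp only: integral_trajectory_Suc Suc.IH funpow_Suc_right comp_def)
qed

section \<open>The Bellman equation of a policy\<close>

definition soft_Q :: "('s, 'a) kernel \<Rightarrow> ('s \<Rightarrow> 'a \<Rightarrow> real) \<Rightarrow> real \<Rightarrow> ('s \<Rightarrow> real) \<Rightarrow> 's \<Rightarrow> 'a \<Rightarrow> real"
where
  "soft_Q T f \<gamma> w s a = f s a + \<gamma> * (\<Sum>s'\<in>UNIV. pmf (T s a) s' * w s')"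

text \<open>The policy evaluation operator, affine in \<open>w\<close>. An action of probability 0
  contributes 0, whatever value \<open>ln 0\<close> has.\<close>

definition bellman ::
  "('s, 'a) kernel \<Rightarrow> ('s \<Rightarrow> 'a \<Rightarrow> real) \<Rightarrow> real \<Rightarrow> real \<Rightarrow> ('s, 'a) policy \<Rightarrow> ('s \<Rightarrow> real) \<Rightarrow> 's \<Rightarrow> real"
where
  "bellman T f \<gamma> lam \<pi> w s = (\<Sum>a\<in>UNIV. pmf (\<pi> s) a * (soft_Q T f \<gamma> w s a - lam * ln (pmf (\<pi> s) a)))"

text \<open>The value is the series of \<open>\<gamma> ^ t * (P ^^ t) r\<close>, where
  \<open>r\<close> is the mean one-step reward with entropy. Splitting off the term at
  \<open>t = 0\<close> leaves \<open>\<gamma> * P\<close> applied to the same series.\<close>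

lemma regularized_value_bellman:
  fixes T :: "('s::finite, 'a::finite) kernel"
  assumes \<gamma>: "0 \<le> \<gamma>" "\<gamma> < 1"
  shows "regularized_value T f \<gamma> lam \<pi> s
    = bellman T f \<gamma> lam \<pi> (regularized_value T f \<gamma> lam \<pi>) s"
proof -
  define g where "g = (\<lambda>p. f (fst p) (snd p) - lam * ln (pmf (\<pi> (fst p)) (snd p)))"
  define B where "B = Max (range (\<lambda>p. \<bar>g p\<bar>))"
  define P where "P = (\<lambda>u. policy_mean \<pi> (next_mean T u))"
  define r where "r = policy_mean \<pi> g"
  let ?V = "regularized_value T f \<gamma> lam \<pi>"
  have B: "\<bar>g p\<bar> \<le> B" for p
    unfolding B_def by (rule Max_ge) auto
  have summ: "summable (\<lambda>t. \<gamma> ^ t * B)"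
    using \<gamma> by (intro summable_mult2 summable_geometric) auto
  have bound: "norm (\<gamma> ^ t * g p) \<le> \<gamma> ^ t * B" for t p
    using \<gamma> B by (simp add: abs_mult mult_left_mono)
  have V: "(\<lambda>t. \<gamma> ^ t * (P ^^ t) r s) sums ?V s" for s
  proof -
    interpret prob_space "trajectory T \<pi> s"
      by (rule prob_space_trajectory)
    have int: "integrable (trajectory T \<pi> s) (\<lambda>\<omega>. \<gamma> ^ t * g (\<omega> t))" for t
      by (intro integrable_mult_right integrable_trajectory_component)
    \<comment> \<open>Expectation and series are exchanged by domination with
      \<open>\<gamma> ^ t * B\<close>.\<close>
    have "(\<lambda>t. \<integral>\<omega>. \<gamma> ^ t * g (\<omega> t) \<partial>trajectory T \<pi> s)
        sums (\<integral>\<omega>. (\<Sum>t. \<gamma> ^ t * g (\<omega> t)) \<partial>trajectory T \<pi> s)"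
    proof (rule sums_integral[OF int])
      show "AE \<omega> in trajectory T \<pi> s. summable (\<lambda>t. norm (\<gamma> ^ t * g (\<omega> t)))"
        using bound by (intro AE_I2 summable_comparison_test'[OF summ]) auto
      have "(\<integral>\<omega>. norm (\<gamma> ^ t * g (\<omega> t)) \<partial>trajectory T \<pi> s) \<le> \<gamma> ^ t * B" for t
        using int bound by (intro integral_le_const integrable_norm AE_I2) auto
      then show "summable (\<lambda>t. \<integral>\<omega>. norm (\<gamma> ^ t * g (\<omega> t)) \<partial>trajectory T \<pi> s)"
        by (intro summable_comparison_test'[OF summ]) simp
    qed
    then show ?thesis
      by (simp add: integral_trajectory[of T \<pi> s g] r_def[symmetric] P_def[symmetric])
        (simp add: g_def regularized_value_def)
  qed
  \<comment> \<open>\<open>P\<close> is a finite weighted sum, hence passes through the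
    series.\<close>
  have "(\<lambda>t. \<gamma> * P (\<lambda>s. \<gamma> ^ t * (P ^^ t) r s) s) sums (\<gamma> * P ?V s)"
    unfolding P_def policy_mean_def next_mean_def
    by (intro sums_mult sums_sum V[unfolded P_def policy_mean_def next_mean_def])
  moreover have "\<gamma> * P (\<lambda>s. \<gamma> ^ t * (P ^^ t) r s) s = \<gamma> ^ Suc t * (P ^^ Suc t) r s" for t
    unfolding P_def policy_mean_def next_mean_def by (simp add: sum_distrib_left mult_ac)
  ultimately have "(\<lambda>t. \<gamma> ^ Suc t * (P ^^ Suc t) r s) sums (\<gamma> * P ?V s)"
    by simp
  from sums_Suc[OF this] have "(\<lambda>t. \<gamma> ^ t * (P ^^ t) r s) sums (\<gamma> * P ?V s + r s)"
    by simp
  with V[of s] have "?V s = \<gamma> * P ?V s + r s"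
    by (rule sums_unique2)
  also have "\<dots> = bellman T f \<gamma> lam \<pi> ?V s"
    by (simp add: P_def r_def g_def bellman_def soft_Q_def policy_mean_def next_mean_def
        sum_distrib_left sum.distrib[symmetric] algebra_simps)
  finally show ?thesis .
qed

section \<open>Comparison of subsolutions and supersolutions with the value\<close>

lemma bellman_diff:
  fixes T :: "('s::finite, 'a::finite) kernel"
  shows "bellman T f \<gamma> lam \<pi> w s - bellman T f \<gamma> lam \<pi> u s
    = \<gamma> * policy_mean \<pi> (next_mean T (\<lambda>s'. w s' - u s')) s"
proof -
  have "pmf (\<pi> s) a * (soft_Q T f \<gamma> w s a - lam * ln (pmf (\<pi> s) a))
      - pmf (\<pi> s) a * (soft_Q T f \<gamma> u s a - lam * ln (pmf (\<pi> s) a))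
      = \<gamma> * (pmf (\<pi> s) a * next_mean T (\<lambda>s'. w s' - u s') (s, a))" for a
    by (simp add: soft_Q_def next_mean_def right_diff_distrib sum_subtractf) (simp add: algebra_simps)
  then show ?thesis
    unfolding bellman_def sum_subtractf[symmetric] policy_mean_def
    by (simp only: sum_distrib_left)
qed

lemma mean_mono:
  fixes T :: "('s::finite, 'a::finite) kernel"
  assumes "\<And>s'. c \<le> D s'"
  shows "c \<le> policy_mean \<pi> (next_mean T D) s"
proof -
  have avg: "c \<le> (\<Sum>x\<in>UNIV. pmf M x * k x)" if "\<And>x. c \<le> k x" for M :: "'b::finite pmf" and k
  proof -
    have "c = (\<Sum>x\<in>UNIV. pmf M x * c)"
      by (simp add: sum_distrib_right[symmetric] sum_pmf_eq_1)
    also have "\<dots> \<le> (\<Sum>x\<in>UNIV. pmf M x * k x)"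
      using that by (intro sum_mono mult_left_mono) auto
    finally show ?thesis .
  qed
  show ?thesis
    unfolding policy_mean_def next_mean_def by (intro avg assms)
qed

text \<open>Minimum principle: at a minimiser of \<open>D\<close> one has \<open>D \<ge> \<gamma> * min D\<close>.\<close>

lemma nonneg_of_discounted_mean:
  fixes T :: "('s::finite, 'a::finite) kernel"
  assumes \<gamma>: "0 \<le> \<gamma>" "\<gamma> < 1"
    and D: "\<And>s. \<gamma> * policy_mean \<pi> (next_mean T D) s \<le> D s"
  shows "0 \<le> D s"
proof -
  have "Min (range D) \<in> range D"
    by (rule Min_in) auto
  then obtain s0 where "Min (range D) = D s0"
    by blast
  then have s0: "D s0 \<le> D s" for s
    using Min_le[of "range D" "D s"] by simp
  have "\<gamma> * D s0 \<le> \<gamma> * policy_mean \<pi> (next_mean T D) s0"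
    using \<gamma> s0 by (intro mult_left_mono mean_mono)
  with D[of s0] have "0 \<le> (1 - \<gamma>) * D s0"
    by (simp add: algebra_simps)
  with \<gamma> have "0 \<le> D s0"
    by (simp add: zero_le_mult_iff)
  with s0[of s] show ?thesis
    by simp
qed

text \<open>The bound is the Bellman image of \<open>w\<close> rather than \<open>w\<close> itself:
  this keeps the relative-entropy gap that later forces uniqueness of the optimal policy.\<close>

lemma regularized_value_le_bellman:
  fixes T :: "('s::finite, 'a::finite) kernel"
  assumes \<gamma>: "0 \<le> \<gamma>" "\<gamma> < 1" and w: "\<And>s. bellman T f \<gamma> lam \<pi> w s \<le> w s"
  shows "regularized_value T f \<gamma> lam \<pi> s \<le> bellman T f \<gamma> lam \<pi> w s"
proof -
  let ?D = "\<lambda>s. w s - regularized_value T f \<gamma> lam \<pi> s"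
  let ?P = "\<lambda>s. policy_mean \<pi> (next_mean T ?D) s"
  \<comment> \<open>The value is a fixed point of the affine operator, so only its linear part,
    applied to \<open>?D\<close>, remains.\<close>
  have diff: "bellman T f \<gamma> lam \<pi> w s - regularized_value T f \<gamma> lam \<pi> s = \<gamma> * ?P s" for s
    using bellman_diff[of T f \<gamma> lam \<pi> w s "regularized_value T f \<gamma> lam \<pi>"]
      regularized_value_bellman[OF \<gamma>, of T f lam \<pi> s] by simp
  have "0 \<le> ?D s" for s
  proof (rule nonneg_of_discounted_mean[OF \<gamma>])
    show "\<gamma> * ?P s \<le> ?D s" for s
      using diff[of s] w[of s] by linarith
  qed
  then have "0 \<le> \<gamma> * ?P s"
    using \<gamma> by (intro mult_nonneg_nonneg mean_mono)
  with diff[of s] show ?thesis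
    by linarith
qed

text \<open>The same argument with the sign of \<open>?D\<close> reversed.\<close>

lemma bellman_le_regularized_value:
  fixes T :: "('s::finite, 'a::finite) kernel"
  assumes \<gamma>: "0 \<le> \<gamma>" "\<gamma> < 1" and w: "\<And>s. w s \<le> bellman T f \<gamma> lam \<pi> w s"
  shows "bellman T f \<gamma> lam \<pi> w s \<le> regularized_value T f \<gamma> lam \<pi> s"
proof -
  let ?D = "\<lambda>s. regularized_value T f \<gamma> lam \<pi> s - w s"
  let ?P = "\<lambda>s. policy_mean \<pi> (next_mean T ?D) s"
  have diff: "regularized_value T f \<gamma> lam \<pi> s - bellman T f \<gamma> lam \<pi> w s = \<gamma> * ?P s" for s
    using bellman_diff[of T f \<gamma> lam \<pi> "regularized_value T f \<gamma> lam \<pi>" s w]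
      regularized_value_bellman[OF \<gamma>, of T f lam \<pi> s] by simp
  have "0 \<le> ?D s" for s
  proof (rule nonneg_of_discounted_mean[OF \<gamma>])
    show "\<gamma> * ?P s \<le> ?D s" for s
      using diff[of s] w[of s] by linarith
  qed
  then have "0 \<le> \<gamma> * ?P s"
    using \<gamma> by (intro mult_nonneg_nonneg mean_mono)
  with diff[of s] show ?thesis
    by linarith
qed

section \<open>Entropy and the soft maximum\<close>

text \<open>The sum is minus the relative entropy of \<open>p\<close> with respect to
  \<open>q\<close>. Both parts come from \<open>ln x \<le> x - 1\<close> at
  \<open>x = pmf q a / pmf p a\<close>, with equality only at \<open>x = 1\<close>.\<close>

lemma gibbs:
  fixes p q :: "'a::finite pmf"
  assumes q: "\<And>a. pmf q a > 0"
  shows "(\<Sum>a\<in>UNIV. pmf p a * (ln (pmf q a) - ln (pmf p a))) \<le> 0"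
    and "(\<Sum>a\<in>UNIV. pmf p a * (ln (pmf q a) - ln (pmf p a))) = 0 \<Longrightarrow> p = q"
proof -
  \<comment> \<open>The added terms \<open>pmf q a - pmf p a\<close> sum to 0 and make each summand
    nonnegative.\<close>
  define \<delta> where "\<delta> = (\<lambda>a. pmf q a - pmf p a - pmf p a * (ln (pmf q a) - ln (pmf p a)))"
  have expand: "\<delta> a = pmf p a * (pmf q a / pmf p a - 1 - ln (pmf q a / pmf p a))"
    if "pmf p a > 0" for a
    using that q[of a] by (simp add: \<delta>_def ln_div field_simps)
  have nonneg: "0 \<le> \<delta> a" for a
  proof (cases "pmf p a = 0")
    case False
    then have "pmf p a > 0"
      by (simp add: pmf_pos)
    then show ?thesis
      using ln_le_minus_one[of "pmf q a / pmf p a"] q[of a] by (simp add: expand)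
  qed (simp add: \<delta>_def)
  have sum: "(\<Sum>a\<in>UNIV. \<delta> a) = - (\<Sum>a\<in>UNIV. pmf p a * (ln (pmf q a) - ln (pmf p a)))"
    by (simp add: \<delta>_def sum_subtractf sum_pmf_eq_1)
  show "(\<Sum>a\<in>UNIV. pmf p a * (ln (pmf q a) - ln (pmf p a))) \<le> 0"
    using sum_nonneg[of UNIV \<delta>] nonneg sum by simp
  assume "(\<Sum>a\<in>UNIV. pmf p a * (ln (pmf q a) - ln (pmf p a))) = 0"
  with sum nonneg have zero: "\<delta> a = 0" for a
    using sum_nonneg_eq_0_iff[of UNIV \<delta>] by simp
  show "p = q"
  proof (rule pmf_eqI)
    fix a
    \<comment> \<open>If \<open>pmf p a\<close> were 0, then \<open>\<delta> a\<close> would be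
      \<open>pmf q a > 0\<close>.\<close>
    have pos: "pmf p a > 0"
      using zero[of a] q[of a] by (cases "pmf p a = 0") (auto simp: \<delta>_def pmf_pos)
    with zero[of a] have "ln (pmf q a / pmf p a) = pmf q a / pmf p a - 1"
      by (simp add: expand)
    with pos q[of a] have "pmf q a / pmf p a = 1"
      by (intro ln_eq_minus_one) auto
    with pos show "pmf p a = pmf q a"
      by (simp add: field_simps)
  qed
qed

text \<open>Normalising \<open>exp (q a / lam)\<close> gives \<open>\<rho>\<close>; the constant is
  \<open>c = lam * ln Z\<close>, the soft maximum of \<open>q\<close>.\<close>

lemma softmax_exists:
  fixes q :: "'a::finite \<Rightarrow> real"
  assumes lam: "lam > 0"
  obtains \<rho> :: "'a pmf" and c where "\<And>a. pmf \<rho> a > 0" "\<And>a. q a = lam * ln (pmf \<rho> a) + c"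
proof -
  define Z where "Z = (\<Sum>a\<in>UNIV. exp (q a / lam))"
  have Z: "Z > 0"
    unfolding Z_def by (intro sum_pos) auto
  have "(\<Sum>a\<in>UNIV. exp (q a / lam) / Z) = 1"
    using Z by (simp add: Z_def sum_divide_distrib[symmetric])
  then have pmf: "pmf (embed_pmf (\<lambda>a. exp (q a / lam) / Z)) a = exp (q a / lam) / Z" for a
    using Z by (intro pmf_embed_pmf) (auto simp: nn_integral_count_space_finite)
  show ?thesis
    by (rule that[of "embed_pmf (\<lambda>a. exp (q a / lam) / Z)" "lam * ln Z"])
      (use Z lam in \<open>auto simp: pmf ln_div field_simps\<close>)
qed

text \<open>The constant \<open>c\<close> comes out because probabilities sum to 1; for positive
  \<open>\<rho>\<close> the remaining sum is minus a relative entropy.\<close>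

lemma bellman_of_soft_Q:
  fixes T :: "('s::finite, 'a::finite) kernel"
  assumes "\<And>a. soft_Q T f \<gamma> w s a = lam * ln (pmf \<rho> a) + c"
  shows "bellman T f \<gamma> lam \<pi> w s
    = c + lam * (\<Sum>a\<in>UNIV. pmf (\<pi> s) a * (ln (pmf \<rho> a) - ln (pmf (\<pi> s) a)))"
proof -
  have "bellman T f \<gamma> lam \<pi> w s
      = (\<Sum>a\<in>UNIV. pmf (\<pi> s) a * c + lam * (pmf (\<pi> s) a * (ln (pmf \<rho> a) - ln (pmf (\<pi> s) a))))"
    unfolding bellman_def assms by (intro sum.cong) (auto simp: algebra_simps)
  then show ?thesis
    by (simp add: sum.distrib sum_distrib_left[symmetric] sum_distrib_right[symmetric] sum_pmf_eq_1)
qed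

section \<open>Optimal policies and their soft Q-functions\<close>

lemma optimal_value_eq:
  assumes "optimal_policy T f \<gamma> lam \<pi>"
  shows "optimal_value T f \<gamma> lam = regularized_value T f \<gamma> lam \<pi>"
proof
  fix s
  \<comment> \<open>One policy attains the maximum in every state, so \<open>GREATEST\<close> is
    well defined.\<close>
  show "optimal_value T f \<gamma> lam s = regularized_value T f \<gamma> lam \<pi> s"
    unfolding optimal_value_def
    by (rule Greatest_equality) (use assms in \<open>auto simp: optimal_policy_def\<close>)
qed

text \<open>Verification: \<open>v\<close> is a supersolution for every policy and an exact solution
  for \<open>\<rho>\<close>.\<close>

lemma optimal_of_soft_Q:
  fixes T :: "('s::finite, 'a::finite) kernel"
  assumes lam: "lam > 0" and \<gamma>: "0 \<le> \<gamma>" "\<gamma> < 1" and pos: "\<And>s a. pmf (\<rho> s) a > 0"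
    and Q: "\<And>s a. soft_Q T f \<gamma> v s a = lam * ln (pmf (\<rho> s) a) + v s"
  shows "optimal_value T f \<gamma> lam = v" and "optimal_policy T f \<gamma> lam \<pi> \<longleftrightarrow> \<pi> = \<rho>"
proof -
  let ?V = "\<lambda>\<pi>. regularized_value T f \<gamma> lam \<pi>"
  let ?G = "\<lambda>\<pi> s. \<Sum>a\<in>UNIV. pmf (\<pi> s) a * (ln (pmf (\<rho> s) a) - ln (pmf (\<pi> s) a))"
  have bell: "bellman T f \<gamma> lam \<pi> v s = v s + lam * ?G \<pi> s" for \<pi> s
    by (rule bellman_of_soft_Q) (rule Q)
  have G: "lam * ?G \<pi> s \<le> 0" for \<pi> s
    using lam gibbs(1)[OF pos] by (simp add: mult_le_0_iff)
  have le: "?V \<pi> s \<le> v s + lam * ?G \<pi> s" for \<pi> s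
    using regularized_value_le_bellman[OF \<gamma>, of T f lam \<pi> v s] G by (simp add: bell)
  have V_le: "?V \<pi> s \<le> v s" for \<pi> s
    using le[of \<pi> s] G[of \<pi> s] by linarith
  have "v s \<le> ?V \<rho> s" for s
    using bellman_le_regularized_value[OF \<gamma>, of v T f lam \<rho> s] by (simp add: bell)
  with V_le have V: "?V \<rho> s = v s" for s
    by (intro antisym) auto
  then have opt: "optimal_policy T f \<gamma> lam \<rho>"
    using V_le by (simp add: optimal_policy_def)
  show "optimal_value T f \<gamma> lam = v"
    using optimal_value_eq[OF opt] V by (simp add: fun_eq_iff)
  have "\<pi> = \<rho>" if "optimal_policy T f \<gamma> lam \<pi>"
  proof
    fix s
    have "v s \<le> ?V \<pi> s"
      using that V[of s] by (metis optimal_policy_def)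
    \<comment> \<open>Attaining \<open>v s\<close> leaves no room for a relative-entropy loss in
      state \<open>s\<close>.\<close>
    with le[of \<pi> s] G[of \<pi> s] have "lam * ?G \<pi> s = 0"
      by linarith
    with lam show "\<pi> s = \<rho> s"
      using gibbs(2)[OF pos, of "\<pi> s" s] by simp
  qed
  with opt show "optimal_policy T f \<gamma> lam \<pi> \<longleftrightarrow> \<pi> = \<rho>"
    by blast
qed

text \<open>Policy improvement: passing from \<open>\<pi>\<close> to the softmax policy of its own \<open>soft_Q\<close> gains at
  least \<open>lam\<close> times a relative entropy, so optimality forces the two policies to agree.\<close>

lemma soft_Q_of_optimal_policy:
  fixes T :: "('s::finite, 'a::finite) kernel"
  assumes lam: "lam > 0" and \<gamma>: "0 \<le> \<gamma>" "\<gamma> < 1" and opt: "optimal_policy T f \<gamma> lam \<pi>"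
    and v: "v = regularized_value T f \<gamma> lam \<pi>"
  shows "soft_Q T f \<gamma> v s a = lam * ln (pmf (\<pi> s) a) + v s"
proof -
  \<comment> \<open>The softmax constant in state \<open>s\<close> is not yet known to be
    \<open>v s\<close>, so it is kept as a separate \<open>c s\<close>.\<close>
  have "\<exists>\<rho> c. (\<forall>a. pmf \<rho> a > 0) \<and> (\<forall>a. soft_Q T f \<gamma> v s a = lam * ln (pmf \<rho> a) + c)" for s
    using softmax_exists[OF lam, of "soft_Q T f \<gamma> v s"] by metis
  then obtain \<rho> c where pos: "\<And>s a. pmf (\<rho> s) a > 0"
    and Q: "\<And>s a. soft_Q T f \<gamma> v s a = lam * ln (pmf (\<rho> s) a) + c s"
    by metis
  let ?G = "\<lambda>s. \<Sum>a\<in>UNIV. pmf (\<pi> s) a * (ln (pmf (\<rho> s) a) - ln (pmf (\<pi> s) a))"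
  have v_eq: "v s = c s + lam * ?G s" for s
    using regularized_value_bellman[OF \<gamma>, of T f lam \<pi> s]
      bellman_of_soft_Q[of T f \<gamma> v s lam "\<rho> s" "c s" \<pi>, OF Q] by (simp add: v)
  have bell: "bellman T f \<gamma> lam \<rho> v s = c s" for s
    using bellman_of_soft_Q[of T f \<gamma> v s lam "\<rho> s" "c s" \<rho>, OF Q] by simp
  have G: "lam * ?G s \<le> 0" for s
    using lam gibbs(1)[OF pos] by (simp add: mult_le_0_iff)
  \<comment> \<open>A chain that closes up: \<open>v s\<close> is at most \<open>c s\<close>, which
    is at most the value of \<open>\<rho>\<close>, which is at most \<open>v s\<close> by optimality
    of \<open>\<pi>\<close>.\<close>
  have "v s \<le> bellman T f \<gamma> lam \<rho> v s" for s
    using v_eq[of s] G[of s] bell[of s] by linarith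
  then have "c s \<le> regularized_value T f \<gamma> lam \<rho> s"
    using bellman_le_regularized_value[OF \<gamma>, of v T f lam \<rho> s] bell by simp
  also have "\<dots> \<le> v s"
    using opt by (simp add: optimal_policy_def v)
  finally have c: "c s = v s" and "lam * ?G s = 0"
    using v_eq[of s] G[of s] by linarith+
  then have "\<pi> s = \<rho> s"
    using lam gibbs(2)[OF pos, of "\<pi> s" s] by simp
  with Q[of s a] c show ?thesis
    by simp
qed

theorem theorem1:
  fixes T :: "'s::finite \<Rightarrow> 'a::finite \<Rightarrow> 's pmf"
    and \<pi>bar :: "'s \<Rightarrow> 'a pmf"
    and v :: "'s \<Rightarrow> real"
    and \<gamma> lam :: real
  assumes "lam > 0" and "0 \<le> \<gamma>" and "\<gamma> < 1"
    and "\<And>s a. pmf (\<pi>bar s) a > 0"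
  shows "(\<exists>!f :: 's \<Rightarrow> 'a \<Rightarrow> real.
            optimal_value T f \<gamma> lam = v \<and>
            (\<forall>\<pi>. optimal_policy T f \<gamma> lam \<pi> \<longleftrightarrow> \<pi> = \<pi>bar)) \<and>
         (\<forall>f :: 's \<Rightarrow> 'a \<Rightarrow> real.
            optimal_value T f \<gamma> lam = v \<and>
            (\<forall>\<pi>. optimal_policy T f \<gamma> lam \<pi> \<longleftrightarrow> \<pi> = \<pi>bar) \<longrightarrow>
            (\<forall>s a. f s a = lam * ln (pmf (\<pi>bar s) a)
                          - \<gamma> * (\<Sum>s'\<in>UNIV. pmf (T s a) s' * v s') + v s))"
proof -
  let ?sol = "\<lambda>f. optimal_value T f \<gamma> lam = v \<and>
      (\<forall>\<pi>. optimal_policy T f \<gamma> lam \<pi> \<longleftrightarrow> \<pi> = \<pi>bar)"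
  define f0 where "f0 = (\<lambda>s a. lam * ln (pmf (\<pi>bar s) a)
      - \<gamma> * (\<Sum>s'\<in>UNIV. pmf (T s a) s' * v s') + v s)"
  \<comment> \<open>\<open>f0\<close> is this identity solved for the reward.\<close>
  have "soft_Q T f0 \<gamma> v s a = lam * ln (pmf (\<pi>bar s) a) + v s" for s a
    by (simp add: soft_Q_def f0_def)
  then have sol: "?sol f0"
    using optimal_of_soft_Q[of lam \<gamma> \<pi>bar T f0 v] assms by simp
  have unique: "f s a = f0 s a" if "?sol f" for f s a
  proof -
    have opt: "optimal_policy T f \<gamma> lam \<pi>bar"
      using that by simp
    \<comment> \<open>With \<open>v\<close> identified as the value of \<open>\<pi>bar\<close>, the
      soft Q-function of \<open>f\<close> is known explicitly, and subtracting its discounted part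
      leaves \<open>f\<close>.\<close>
    have "v = regularized_value T f \<gamma> lam \<pi>bar"
      using optimal_value_eq[OF opt] that by simp
    from soft_Q_of_optimal_policy[OF assms(1-3) opt this, of s a] show ?thesis
      by (simp add: soft_Q_def f0_def)
  qed
  have "\<exists>!f. ?sol f"
  proof (rule ex1I[of _ f0])
    show "?sol f0" by (rule sol)
    show "f = f0" if "?sol f" for f using unique[OF that] by (intro ext)
  qed
  moreover have "\<forall>f. ?sol f \<longrightarrow> (\<forall>s a. f s a = lam * ln (pmf (\<pi>bar s) a)
      - \<gamma> * (\<Sum>s'\<in>UNIV. pmf (T s a) s' * v s') + v s)"
    using unique unfolding f0_def by blast
  ultimately show ?thesis
    by (rule conjI)
qed

end
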